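(* Consider the edge-balanced dynamics with unit edge weights and smoothing parameter $\alpha$ on a cycle with $n$ matched edges. For every $\alpha\in(0,1)$, the convergence time $T$ (as $n\to\infty$ with $\alpha$ fixed) is $$T=\frac{1}{2\alpha\pi^2}\,n^2\cdot\left[1+O(1/n^2)\right].$$
   Context: Edge-balanced dynamics. Let $G=(V,E)$ be a graph with all edge weights equal to $1$, and let $M\subset E$ be a fixed matching; $p_i$ denotes the partner of a matched node $i$. Fix $0<\alpha\le1$. Node values evolve for $t=0,1,\dots$ by $$x_i(t+1)=x_i(t)+\alpha\left\{\left[u_i(t)+\tfrac12(1-u_i(t)-u_{p_i}(t))\right]_0^{1}-x_i(t)\right\},\quad u_l(t)=\max_{k:(l,k)\in E\setminus M}(1-x_k(t))_+,$$ where $[\cdot]_a^b=\min(\max(\cdot,a),b)$ and $(\cdot)_+=\max(0,\cdot)$. Node values lie in $[0,1]$ and the two values on each matched edge sum to $1$. Cycle. The cycle has $n$ matched edges alternating with $n$ unmatched edges; going around the cycle, the $i$-th matched edge has end nodes with values $x_i$ and $1-x_i$ (in this order). The dynamics is the linear system $$\vec{x}(t+1)=\mathbf{A}_\alpha\vec{x}(t),\qquad \mathbf{A}_\alpha=(1-\alpha)\mathbf{I}+\alpha\mathbf{A},$$ where $\mathbf{A}$ is the $n\times n$ circulant matrix with $(\mathbf{A}\vec{x})_i=\frac12(x_{i-1}+x_{i+1})$, indices modulo $n$. Convergence time. For a linear system $\vec{x}(t+1)=\mathbf{B}\vec{x}(t)$ that converges from every initial value to a limit point which may depend on the initial value, the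 rate of convergence is $R=\log(1/\lambda_2(\mathbf{B}))$, where $\lambda_2(\mathbf{B})$ is the largest modulus, among those strictly smaller than $1$, of an eigenvalue of $\mathbf{B}$; the convergence time is $T=1/R$. Here $\mathbf{B}=\mathbf{A}_\alpha$. *)

theory Defs
  imports
    "HOL-Library.Landau_Symbols"
    "Jordan_Normal_Form.Spectral_Radius"
begin

section \<open>Edge-balanced dynamics with unit edge weights\<close>

text \<open>Edges are unordered pairs \<open>{i, j}\<close>; \<open>E\<close> is the edge set of the graph and
  \<open>M \<subseteq> E\<close> the matching.\<close>

definition partner :: "'v set set \<Rightarrow> 'v \<Rightarrow> 'v" where
  "partner M i = (THE j. {i, j} \<in> M)"

text \<open>Inserting \<open>0\<close> only affects nodes without unmatched edges, for which the maximum ranges over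
  the empty set; all other values are nonnegative anyway.\<close>

definition best_alternative :: "'v set set \<Rightarrow> 'v set set \<Rightarrow> ('v \<Rightarrow> real) \<Rightarrow> 'v \<Rightarrow> real" where
  "best_alternative E M x l = Max (insert 0 ((\<lambda>k. max 0 (1 - x k)) ` {k. {l, k} \<in> E - M}))"

definition clip :: "real \<Rightarrow> real \<Rightarrow> real \<Rightarrow> real" where
  "clip a b z = min (max z a) b"

text \<open>The update is meaningful at matched nodes, i.e. on \<open>\<Union>M\<close>.\<close>

definition edge_balanced_step ::
    "'v set set \<Rightarrow> 'v set set \<Rightarrow> real \<Rightarrow> ('v \<Rightarrow> real) \<Rightarrow> 'v \<Rightarrow> real" where
  "edge_balanced_step E M \<alpha> x i =
     (let u = best_alternative E M x
      in x i + \<alpha> * (clip 0 1 (u i + 1/2 * (1 - u i - u (partner M i))) - x i))"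


section \<open>The cycle with \<open>n\<close> matched edges\<close>

text \<open>Going around the cycle, the nodes are
  \<open>(0,False), (0,True), (1,False), (1,True), \<dots>, (n-1,False), (n-1,True)\<close>. Matched edge \<open>i\<close> joins
  \<open>(i,False)\<close>, with value \<open>x\<^sub>i\<close>, to \<open>(i,True)\<close>, with value \<open>1 - x\<^sub>i\<close>; indices start at \<open>0\<close>.
  The graph is a (simple) cycle for \<open>n \<ge> 2\<close>.\<close>

definition cycle_matching :: "nat \<Rightarrow> (nat \<times> bool) set set" where
  "cycle_matching n = {{(i, False), (i, True)} | i. i < n}"

definition cycle_edges :: "nat \<Rightarrow> (nat \<times> bool) set set" where
  "cycle_edges n = cycle_matching n \<union> {{(i, True), ((i + 1) mod n, False)} | i. i < n}"

definition admissible :: "nat \<Rightarrow> (nat \<times> bool \<Rightarrow> real) \<Rightarrow> bool" where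
  "admissible n x \<longleftrightarrow>
     (\<forall>i<n. x (i, False) \<in> {0..1} \<and> x (i, True) \<in> {0..1} \<and> x (i, False) + x (i, True) = 1)"

definition cycle_coords :: "nat \<Rightarrow> (nat \<times> bool \<Rightarrow> real) \<Rightarrow> real vec" where
  "cycle_coords n x = vec n (\<lambda>i. x (i, False))"

text \<open>On admissible states the dynamics on the cycle is the linear system with matrix \<open>B\<close>.\<close>

definition cycle_dynamics_is_linear :: "nat \<Rightarrow> real \<Rightarrow> real mat \<Rightarrow> bool" where
  "cycle_dynamics_is_linear n \<alpha> B \<longleftrightarrow>
     (\<forall>x. admissible n x \<longrightarrow>
        (let x' = edge_balanced_step (cycle_edges n) (cycle_matching n) \<alpha> x
         in admissible n x' \<and> cycle_coords n x' = B *\<^sub>v cycle_coords n x))"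

text \<open>Each neighbour contributes its own \<open>1/2\<close>, so that for \<open>n = 2\<close>, where \<open>i - 1\<close> and \<open>i + 1\<close>
  coincide, the off-diagonal entries are \<open>1\<close>.\<close>

definition cycle_mat :: "nat \<Rightarrow> real mat" where
  "cycle_mat n = mat n n (\<lambda>(i, j).
     1/2 * of_bool (i = (j + 1) mod n) + 1/2 * of_bool (j = (i + 1) mod n))"

definition smoothed_cycle_mat :: "real \<Rightarrow> nat \<Rightarrow> real mat" where
  "smoothed_cycle_mat \<alpha> n = (1 - \<alpha>) \<cdot>\<^sub>m 1\<^sub>m n + \<alpha> \<cdot>\<^sub>m cycle_mat n"


section \<open>Convergence time of a linear system\<close>

definition convergent_system :: "real mat \<Rightarrow> bool" where
  "convergent_system B \<longleftrightarrow>
     (\<forall>v \<in> carrier_vec (dim_row B). \<forall>i < dim_row B. convergent (\<lambda>t. ((B ^\<^sub>m t) *\<^sub>v v) $ i))"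

text \<open>Eigenvalues are complex. The quantities below are meaningful for a convergent system which has
  an eigenvalue of modulus strictly between \<open>0\<close> and \<open>1\<close>.\<close>

definition lambda2 :: "real mat \<Rightarrow> real" where
  "lambda2 B = Max {cmod \<mu> | \<mu>. \<mu> \<in> spectrum (map_mat complex_of_real B) \<and> cmod \<mu> < 1}"

definition convergence_rate :: "real mat \<Rightarrow> real" where
  "convergence_rate B = ln (1 / lambda2 B)"

definition convergence_time :: "real mat \<Rightarrow> real" where
  "convergence_time B = 1 / convergence_rate B"

end

theory Submission
  imports Defs "HOL-Real_Asymp.Real_Asymp"
begin

text \<open>
  The Fourier vectors diagonalise the symmetric circulant matrix, with eigenvalues
  \<open>1 - \<alpha> + \<alpha> cos (2\<pi>k/n)\<close>. All of these lie in \<open>(-1, 1]\<close> for \<open>0 < \<alpha> < 1\<close>, whence convergence. The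
  smallest one is at least \<open>1 - 2\<alpha>\<close>, so for large \<open>n\<close> the second largest modulus belongs to \<open>k = 1\<close>.
  With \<open>h = 2\<pi>/n\<close> and \<open>z = \<alpha> (1 - cos h) = \<alpha> h\<^sup>2/2 + O(h\<^sup>4)\<close> the rate is
  \<open>-ln (1 - z) = z + O(z\<^sup>2)\<close>, and \<open>\<alpha> h\<^sup>2/2 = 2 \<alpha> \<pi>\<^sup>2/n\<^sup>2\<close>.
\<close>

section \<open>Row action of the smoothed circulant matrix\<close>

text \<open>Solves the entry condition of the matrix for the column index. The predecessor is
  written with \<open>+ n\<close> because natural subtraction would truncate at
  \<open>i = 0\<close>.\<close>

lemma succ_mod_eq_iff:
  assumes "i < n" and "j < n"
  shows "i = (j + 1) mod n \<longleftrightarrow> j = (i + n - 1) mod (n::nat)"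
proof (cases "i = 0")
  case True
  then show ?thesis using assms by (cases "j + 1 = n") auto
next
  case False
  then have "i + n - 1 = (i - 1) + n" by simp
  then have "(i + n - 1) mod n = i - 1" using assms by (simp only: mod_add_self2) simp
  then show ?thesis using assms False by (cases "j + 1 = n") auto
qed

lemma dim_smoothed [simp]:
  "dim_row (smoothed_cycle_mat \<alpha> n) = n" "dim_col (smoothed_cycle_mat \<alpha> n) = n"
  by (simp_all add: smoothed_cycle_mat_def cycle_mat_def)

lemma smoothed_carrier [simp]: "smoothed_cycle_mat \<alpha> n \<in> carrier_mat n n"
  by (simp add: carrier_matI)

text \<open>Generic in the field: real vectors serve the dynamics, complex ones the Fourier
  vectors.\<close>

lemma smoothed_mult_vec:
  fixes v :: "'a :: real_field vec"
  assumes v: "v \<in> carrier_vec n" and i: "i < n"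
  shows "(map_mat of_real (smoothed_cycle_mat \<alpha> n) *\<^sub>v v) $ i =
    of_real (1 - \<alpha>) * v $ i + of_real (\<alpha> / 2) * (v $ ((i + n - 1) mod n) + v $ ((i + 1) mod n))"
proof -
  have "(map_mat of_real (smoothed_cycle_mat \<alpha> n) *\<^sub>v v) $ i =
    (\<Sum>j<n. of_real (smoothed_cycle_mat \<alpha> n $$ (i, j)) * v $ j)"
    using v i by (simp add: scalar_prod_def atLeast0LessThan)
  \<comment> \<open>The three contributions stay separate summands, so coinciding neighbours, as for
    \<open>n = 2\<close>, are counted twice.\<close>
  also have "\<dots> = (\<Sum>j<n. (if j = i then of_real (1 - \<alpha>) * v $ j else 0)
      + ((if j = (i + n - 1) mod n then of_real (\<alpha> / 2) * v $ j else 0)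
      + (if j = (i + 1) mod n then of_real (\<alpha> / 2) * v $ j else 0)))"
  proof (rule sum.cong)
    fix j assume "j \<in> {..<n}"
    then have "j < n" by simp
    then show "of_real (smoothed_cycle_mat \<alpha> n $$ (i, j)) * v $ j =
        (if j = i then of_real (1 - \<alpha>) * v $ j else 0)
      + ((if j = (i + n - 1) mod n then of_real (\<alpha> / 2) * v $ j else 0)
      + (if j = (i + 1) mod n then of_real (\<alpha> / 2) * v $ j else 0))"
      using i succ_mod_eq_iff[OF i, of j]
      by (auto simp: smoothed_cycle_mat_def cycle_mat_def algebra_simps)
  qed simp
  also have "\<dots> = of_real (1 - \<alpha>) * v $ i
      + of_real (\<alpha> / 2) * (v $ ((i + n - 1) mod n) + v $ ((i + 1) mod n))"
    using i by (simp add: sum.distrib algebra_simps)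
  finally show ?thesis .
qed

lemma transpose_smoothed: "transpose_mat (smoothed_cycle_mat \<alpha> n) = smoothed_cycle_mat \<alpha> n"
  by (rule eq_matI) (auto simp: smoothed_cycle_mat_def cycle_mat_def)


section \<open>Linearity of the dynamics\<close>

lemma partner_cycle:
  assumes "i < n"
  shows "partner (cycle_matching n) (i, b) = (i, \<not> b)"
  unfolding partner_def
proof (rule the_equality)
  show "{(i, b), (i, \<not> b)} \<in> cycle_matching n"
    using assms unfolding cycle_matching_def by (cases b) auto
  fix j assume "{(i, b), j} \<in> cycle_matching n"
  then show "j = (i, \<not> b)"
    unfolding cycle_matching_def by (auto simp: doubleton_eq_iff)
qed

text \<open>For \<open>n = 1\<close> the connecting edge would be the matched pair itself;
  \<open>2 \<le> n\<close> keeps the two kinds disjoint.\<close>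

lemma unmatched_edges:
  assumes "2 \<le> n"
  shows "cycle_edges n - cycle_matching n = {{(i, True), ((i + 1) mod n, False)} | i. i < n}"
proof -
  have "(i + 1) mod n \<noteq> i" if "i < n" for i
    using assms that by (cases "i + 1 = n") auto
  then show ?thesis
    unfolding cycle_edges_def cycle_matching_def by (fastforce simp: doubleton_eq_iff)
qed

text \<open>Every node has exactly one unmatched edge, so there is one candidate. Admissibility
  makes the positive part inactive and turns \<open>1 - x (j, True)\<close> into
  \<open>x (j, False)\<close>.\<close>

lemma best_alternative_cycle:
  assumes n: "2 \<le> n" and i: "i < n" and x: "admissible n x"
  shows "best_alternative (cycle_edges n) (cycle_matching n) x (i, False) =
      x ((i + n - 1) mod n, False)"
    and "best_alternative (cycle_edges n) (cycle_matching n) x (i, True) =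
      1 - x ((i + 1) mod n, False)"
proof -
  have adm: "0 \<le> x (j, False)" "x (j, False) \<le> 1" "x (j, True) = 1 - x (j, False)" if "j < n" for j
    using x that unfolding admissible_def by force+
  have lt: "(i + n - 1) mod n < n" "(i + 1) mod n < n" using n by auto
  have "{k. {(i, False), k} \<in> cycle_edges n - cycle_matching n} = {((i + n - 1) mod n, True)}"
    unfolding unmatched_edges[OF n] using succ_mod_eq_iff[OF i] lt
    by (auto simp: doubleton_eq_iff)
  then show "best_alternative (cycle_edges n) (cycle_matching n) x (i, False) =
      x ((i + n - 1) mod n, False)"
    unfolding best_alternative_def using adm[OF lt(1)] by simp
  have "{k. {(i, True), k} \<in> cycle_edges n - cycle_matching n} = {((i + 1) mod n, False)}"
    unfolding unmatched_edges[OF n] using i by (auto simp: doubleton_eq_iff)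
  then show "best_alternative (cycle_edges n) (cycle_matching n) x (i, True) =
      1 - x ((i + 1) mod n, False)"
    unfolding best_alternative_def using adm[OF lt(2)] by simp
qed

lemma convex_step_bounds:
  fixes \<alpha> :: real
  assumes "0 \<le> \<alpha>" "\<alpha> \<le> 1" "a \<in> {0..1}" "b \<in> {0..1}"
  shows "a + \<alpha> * (b - a) \<in> {0..1}"
proof -
  have "a + \<alpha> * (b - a) = (1 - \<alpha>) * a + \<alpha> * b" by (simp add: algebra_simps)
  then show ?thesis
    using convex_bound_le[of a 1 b "1 - \<alpha>" \<alpha>] assms by simp
qed

lemma cycle_dynamics_linear:
  assumes n: "2 \<le> n" and \<alpha>: "0 \<le> \<alpha>" "\<alpha> \<le> 1"
  shows "cycle_dynamics_is_linear n \<alpha> (smoothed_cycle_mat \<alpha> n)"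
  unfolding cycle_dynamics_is_linear_def Let_def
proof (intro allI impI)
  fix x assume x: "admissible n x"
  let ?x = "edge_balanced_step (cycle_edges n) (cycle_matching n) \<alpha> x"
  let ?m = "\<lambda>i. (x ((i + n - 1) mod n, False) + x ((i + 1) mod n, False)) / 2"
  have adm: "x (j, False) \<in> {0..1}" "x (j, True) = 1 - x (j, False)" if "j < n" for j
    using x that unfolding admissible_def by force+
  have m: "?m i \<in> {0..1}" if "i < n" for i
    using adm(1)[of "(i + n - 1) mod n"] adm(1)[of "(i + 1) mod n"] n by auto
  \<comment> \<open>With the alternatives of both ends inserted, the expression under
    \<open>clip\<close> is exactly the mean \<open>?m i\<close>. It lies between \<open>0\<close>
    and \<open>1\<close>, so clipping never acts.\<close>
  have F: "?x (i, False) = x (i, False) + \<alpha> * (?m i - x (i, False))" if i: "i < n" for i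
    using m[OF i] unfolding edge_balanced_step_def Let_def partner_cycle[OF i] clip_def
    by (simp add: best_alternative_cycle[OF n i x, simplified] field_simps)
  \<comment> \<open>Exchanging the roles of the two ends turns the clipped value into
    \<open>1 - ?m i\<close>.\<close>
  have T: "?x (i, True) = 1 - ?x (i, False)" if i: "i < n" for i
    using m[OF i] unfolding F[OF i] unfolding edge_balanced_step_def Let_def partner_cycle[OF i] clip_def
    by (simp add: best_alternative_cycle[OF n i x, simplified] adm(2)[OF i] field_simps)
  have "admissible n ?x"
    unfolding admissible_def
  proof (intro allI impI)
    fix i assume i: "i < n"
    have "?x (i, False) \<in> {0..1}"
      unfolding F[OF i] by (rule convex_step_bounds[OF \<alpha> adm(1)[OF i] m[OF i]])
    then show "?x (i, False) \<in> {0..1} \<and> ?x (i, True) \<in> {0..1} \<and> ?x (i, False) + ?x (i, True) = 1"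
      unfolding T[OF i] by auto
  qed
  moreover have "cycle_coords n ?x = smoothed_cycle_mat \<alpha> n *\<^sub>v cycle_coords n x"
  proof (rule eq_vecI)
    fix i assume "i < dim_vec (smoothed_cycle_mat \<alpha> n *\<^sub>v cycle_coords n x)"
    then have i: "i < n" by simp
    \<comment> \<open>Specialises the generic row formula to real scalars.\<close>
    have id: "map_mat of_real A = A" for A :: "real mat" by (rule eq_matI) auto
    have "cycle_coords n x \<in> carrier_vec n" by (simp add: cycle_coords_def)
    from smoothed_mult_vec[OF this i, of \<alpha>] show
      "cycle_coords n ?x $ i = (smoothed_cycle_mat \<alpha> n *\<^sub>v cycle_coords n x) $ i"
      using i n unfolding id by (simp add: cycle_coords_def F field_simps)
  qed (simp add: cycle_coords_def)
  ultimately show "admissible n ?x \<and> cycle_coords n ?x = smoothed_cycle_mat \<alpha> n *\<^sub>v cycle_coords n x" ..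
qed


section \<open>Spectrum\<close>

definition fourier_vec :: "nat \<Rightarrow> nat \<Rightarrow> complex vec" where
  "fourier_vec n k = vec n (\<lambda>j. cis (2 * pi * real k * real j / real n))"

definition cycle_eigenvalue :: "real \<Rightarrow> nat \<Rightarrow> nat \<Rightarrow> real" where
  "cycle_eigenvalue \<alpha> n k = 1 - \<alpha> + \<alpha> * cos (2 * pi * real k / real n)"

abbreviation complex_smoothed :: "real \<Rightarrow> nat \<Rightarrow> complex mat" where
  "complex_smoothed \<alpha> n \<equiv> map_mat complex_of_real (smoothed_cycle_mat \<alpha> n)"

lemma fourier_carrier [simp]: "fourier_vec n k \<in> carrier_vec n"
  by (simp add: fourier_vec_def)

text \<open>Reducing \<open>j\<close> modulo \<open>n\<close> removes whole turns from the angle;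
  neighbours can thus be evaluated at unreduced indices.\<close>

lemma cis_mod:
  assumes "0 < n"
  shows "cis (2 * pi * real k * real (j mod n) / real n) = cis (2 * pi * real k * real j / real n)"
proof -
  have "real j = real (j mod n) + real n * real (j div n)"
    by (metis mod_mult_div_eq of_nat_add of_nat_mult)
  then have "2 * pi * real k * real j / real n =
      2 * pi * real k * real (j mod n) / real n + 2 * pi * real (k * (j div n))"
    using assms by (simp add: field_simps)
  then show ?thesis by (simp add: cis_mult[symmetric])
qed

text \<open>Cyclic shifts by one multiply the vector by \<open>cis h\<close> and
  \<open>cis (- h)\<close>, where \<open>h = 2 * pi * k / n\<close>; the mean of these factors is
  \<open>cos h\<close>.\<close>

lemma fourier_eigenvector:
  assumes "0 < n"
  shows "complex_smoothed \<alpha> n *\<^sub>v fourier_vec n k =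
    complex_of_real (cycle_eigenvalue \<alpha> n k) \<cdot>\<^sub>v fourier_vec n k"
proof (rule eq_vecI)
  fix i assume "i < dim_vec (complex_of_real (cycle_eigenvalue \<alpha> n k) \<cdot>\<^sub>v fourier_vec n k)"
  then have i: "i < n" by (simp add: fourier_vec_def)
  define a where "a = 2 * pi * real k * real i / real n"
  define h where "h = 2 * pi * real k / real n"
  have nth: "fourier_vec n k $ (j mod n) = cis (2 * pi * real k * real j / real n)" for j
    using assms by (simp add: fourier_vec_def cis_mod)
  \<comment> \<open>The extra \<open>n\<close> in the index contributes \<open>k\<close> full
    turns.\<close>
  have "2 * pi * real k * real (i + n - 1) / real n = a - h + 2 * pi * real k"
    using assms by (simp add: a_def h_def field_simps)
  then have 1: "cis (2 * pi * real k * real (i + n - 1) / real n) = cis (a - h)"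
    by (simp add: cis_mult[symmetric])
  have "2 * pi * real k * real (i + 1) / real n = a + h"
    using assms by (simp add: a_def h_def field_simps)
  then have 2: "cis (2 * pi * real k * real (i + 1) / real n) = cis (a + h)" by simp
  have "cis (a - h) + cis (a + h) = 2 * of_real (cos h) * cis a"
    by (simp add: complex_eq_iff cos_add cos_diff sin_add sin_diff)
  then have "(complex_smoothed \<alpha> n *\<^sub>v fourier_vec n k) $ i =
      of_real (1 - \<alpha>) * cis a + of_real (\<alpha> / 2) * (2 * of_real (cos h) * cis a)"
    unfolding smoothed_mult_vec[OF fourier_carrier i] nth 1 2 using i
    by (simp add: fourier_vec_def a_def)
  also have "\<dots> = of_real (cycle_eigenvalue \<alpha> n k) * cis a"
    by (simp add: cycle_eigenvalue_def h_def algebra_simps)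
  finally show "(complex_smoothed \<alpha> n *\<^sub>v fourier_vec n k) $ i =
      (complex_of_real (cycle_eigenvalue \<alpha> n k) \<cdot>\<^sub>v fourier_vec n k) $ i"
    using i by (simp add: fourier_vec_def a_def)
qed (simp add: fourier_vec_def)

text \<open>The matrix is symmetric, so it moves onto the Fourier vector, its eigenvector. Note that
  \<open>\<bullet>\<close> is bilinear, without conjugation.\<close>

lemma fourier_scalar_prod_smoothed:
  assumes "0 < n" and v: "v \<in> carrier_vec n"
  shows "fourier_vec n k \<bullet> (complex_smoothed \<alpha> n *\<^sub>v v) =
    complex_of_real (cycle_eigenvalue \<alpha> n k) * (fourier_vec n k \<bullet> v)"
proof -
  have A: "complex_smoothed \<alpha> n \<in> carrier_mat n n" by simp
  have "transpose_mat (complex_smoothed \<alpha> n) = complex_smoothed \<alpha> n"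
    by (metis transpose_smoothed map_mat_transpose)
  then have "fourier_vec n k \<bullet> (complex_smoothed \<alpha> n *\<^sub>v v) =
      (complex_smoothed \<alpha> n *\<^sub>v fourier_vec n k) \<bullet> v"
    using transpose_vec_mult_scalar[OF A v fourier_carrier] by simp
  then show ?thesis
    using v by (simp add: fourier_eigenvector[OF assms(1)] smult_scalar_prod_distrib[OF fourier_carrier v])
qed

section \<open>Discrete Fourier inversion and completeness\<close>

text \<open>For \<open>j \<noteq> l\<close> this is a geometric sum whose ratio is an
  \<open>n\<close>-th root of unity other than \<open>1\<close>.\<close>

lemma sum_cis_orthogonal:
  assumes "j < n" "l < n"
  shows "(\<Sum>k<n. cis (2 * pi * real k * (real j - real l) / real n)) = (if j = l then of_nat n else 0)"
proof (cases "j = l")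
  case False
  define z where "z = cis (2 * pi * (real j - real l) / real n)"
  have pow: "cis (2 * pi * real k * (real j - real l) / real n) = z ^ k" for k
    by (simp add: z_def Complex.DeMoivre algebra_simps)
  have "z ^ n = cis (2 * pi * of_int (int j - int l))"
    using assms by (simp add: z_def Complex.DeMoivre)
  then have zn: "z ^ n = 1" by (simp only: cis_multiple_2pi Ints_of_int)
  \<comment> \<open>Ratio \<open>1\<close> would make \<open>n\<close> divide \<open>j - l\<close>,
    although \<open>0 < \<bar>j - l\<bar> < n\<close>.\<close>
  have "z \<noteq> 1"
  proof
    assume "z = 1"
    then have "cos (2 * pi * (real j - real l) / real n) = 1"
      by (metis z_def cis.sel(1) one_complex.sel(1))
    then obtain m :: int where "2 * pi * (real j - real l) / real n = of_int m * 2 * pi"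
      using cos_one_2pi_int by blast
    then have "2 * pi * (real j - real l) = 2 * pi * (of_int m * real n)"
      using assms by (simp add: field_simps)
    then have "real j - real l = of_int m * real n" by (simp only: mult_cancel_left) simp
    then have "of_int (int j - int l) = (of_int (m * int n) :: real)" by simp
    then have "int j - int l = m * int n" by (simp only: of_int_eq_iff)
    then have "int n dvd int j - int l" by simp
    then show False using assms False zdvd_imp_le[of "int n" "\<bar>int j - int l\<bar>"] by auto
  qed
  then show ?thesis using False zn by (simp add: pow geometric_sum)
qed simp

text \<open>Swapping the sums leaves the orthogonality relation. In particular, a vector whose
  coefficients all vanish is zero.\<close>

lemma fourier_inversion:
  assumes v: "v \<in> carrier_vec n" and l: "l < n"
  shows "(\<Sum>k<n. cis (- (2 * pi * real k * real l / real n)) * (fourier_vec n k \<bullet> v)) = of_nat n * v $ l"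
proof -
  have "cis (- (2 * pi * real k * real l / real n)) * cis (2 * pi * real k * real j / real n) =
      cis (2 * pi * real k * (real j - real l) / real n)" for j k
    unfolding cis_mult by (rule arg_cong[where f = cis]) (simp add: diff_divide_distrib right_diff_distrib)
  then have "(\<Sum>k<n. cis (- (2 * pi * real k * real l / real n)) * (fourier_vec n k \<bullet> v)) =
      (\<Sum>k<n. \<Sum>j<n. cis (2 * pi * real k * (real j - real l) / real n) * v $ j)"
    using v by (intro sum.cong refl)
      (simp add: scalar_prod_def fourier_vec_def sum_distrib_left atLeast0LessThan flip: mult.assoc)
  also have "\<dots> = (\<Sum>j<n. (\<Sum>k<n. cis (2 * pi * real k * (real j - real l) / real n)) * v $ j)"
    by (subst sum.swap) (simp add: sum_distrib_right)
  also have "\<dots> = (\<Sum>j<n. if j = l then of_nat n * v $ j else 0)"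
    by (intro sum.cong refl) (simp add: sum_cis_orthogonal l)
  also have "\<dots> = of_nat n * v $ l" using l by simp
  finally show ?thesis .
qed

text \<open>No eigenvalue is missed: an eigenvector has a nonzero Fourier coefficient at some
  \<open>k\<close>, and comparing this coefficient before and after applying the matrix forces
  \<open>\<mu>\<close> to be the eigenvalue of \<open>k\<close>.\<close>

lemma spectrum_smoothed:
  assumes n: "0 < n"
  shows "spectrum (complex_smoothed \<alpha> n) = (\<lambda>k. complex_of_real (cycle_eigenvalue \<alpha> n k)) ` {..<n}"
proof (intro equalityI subsetI)
  fix \<mu> assume "\<mu> \<in> spectrum (complex_smoothed \<alpha> n)"
  then obtain v where v: "v \<in> carrier_vec n" "v \<noteq> 0\<^sub>v n" "complex_smoothed \<alpha> n *\<^sub>v v = \<mu> \<cdot>\<^sub>v v"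
    by (auto simp: spectrum_def eigenvalue_def eigenvector_def)
  have "\<exists>k<n. fourier_vec n k \<bullet> v \<noteq> 0"
  proof (rule ccontr)
    assume "\<not> ?thesis"
    then have "v $ l = 0" if "l < n" for l using fourier_inversion[OF v(1) that] n by simp
    then have "v = 0\<^sub>v n" using v(1) by (intro eq_vecI) auto
    then show False using v(2) by simp
  qed
  then obtain k where k: "k < n" "fourier_vec n k \<bullet> v \<noteq> 0" by blast
  have "\<mu> * (fourier_vec n k \<bullet> v) = complex_of_real (cycle_eigenvalue \<alpha> n k) * (fourier_vec n k \<bullet> v)"
    using fourier_scalar_prod_smoothed[OF n v(1), of k \<alpha>] v by simp
  then show "\<mu> \<in> (\<lambda>k. complex_of_real (cycle_eigenvalue \<alpha> n k)) ` {..<n}" using k by auto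
next
  fix \<mu> assume "\<mu> \<in> (\<lambda>k. complex_of_real (cycle_eigenvalue \<alpha> n k)) ` {..<n}"
  then obtain k where k: "\<mu> = complex_of_real (cycle_eigenvalue \<alpha> n k)" by auto
  have "fourier_vec n k $ 0 = 1" using n by (simp add: fourier_vec_def)
  then have "fourier_vec n k \<noteq> 0\<^sub>v n" using n by auto
  then have "eigenvector (complex_smoothed \<alpha> n) (fourier_vec n k) \<mu>"
    unfolding eigenvector_def k using fourier_eigenvector[OF n, of \<alpha> k] by simp
  then show "\<mu> \<in> spectrum (complex_smoothed \<alpha> n)"
    unfolding spectrum_def eigenvalue_def by blast
qed


section \<open>Convergence\<close>

lemma cycle_eigenvalue_bounds:
  assumes "0 < \<alpha>" "\<alpha> < 1"
  shows "1 - 2 * \<alpha> \<le> cycle_eigenvalue \<alpha> n k" "cycle_eigenvalue \<alpha> n k \<le> 1"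
proof -
  have "\<alpha> * (-1) \<le> \<alpha> * cos (2 * pi * real k / real n)" "\<alpha> * cos (2 * pi * real k / real n) \<le> \<alpha> * 1"
    using assms by (intro mult_left_mono; simp)+
  then show "1 - 2 * \<alpha> \<le> cycle_eigenvalue \<alpha> n k" "cycle_eigenvalue \<alpha> n k \<le> 1"
    by (simp_all add: cycle_eigenvalue_def)
qed

text \<open>Inversion writes each coordinate of the iterate as a finite sum of powers
  \<open>cycle_eigenvalue \<alpha> n k ^ t\<close> with coefficients independent of
  \<open>t\<close>.\<close>

lemma convergent_smoothed:
  assumes n: "0 < n" and \<alpha>: "0 < \<alpha>" "\<alpha> < 1"
  shows "convergent_system (smoothed_cycle_mat \<alpha> n)"
  unfolding convergent_system_def dim_smoothed
proof (intro ballI allI impI)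
  fix v :: "real vec" and l assume v: "v \<in> carrier_vec n" and l: "l < n"
  let ?B = "smoothed_cycle_mat \<alpha> n"
  let ?c = "\<lambda>w. map_vec complex_of_real w"
  \<comment> \<open>The induction peels off the first application of \<open>?B\<close>, so the start
    vector \<open>w\<close> must be arbitrary.\<close>
  have step: "fourier_vec n k \<bullet> ?c ((?B ^\<^sub>m t) *\<^sub>v w) =
      complex_of_real (cycle_eigenvalue \<alpha> n k ^ t) * (fourier_vec n k \<bullet> ?c w)"
    if "w \<in> carrier_vec n" for k t w
    using that
  proof (induction t arbitrary: w)
    case 0
    then show ?case by simp
  next
    case (Suc t)
    have "(?B ^\<^sub>m Suc t) *\<^sub>v w = (?B ^\<^sub>m t) *\<^sub>v (?B *\<^sub>v w)"
      using Suc.prems by (simp add: assoc_mult_mat_vec[of _ n n _ n])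
    moreover have "?c (?B *\<^sub>v w) = complex_smoothed \<alpha> n *\<^sub>v ?c w"
      using Suc.prems by (intro of_real_hom.mult_mat_vec_hom) auto
    moreover have "?B *\<^sub>v w \<in> carrier_vec n" by (rule mult_mat_vec_carrier[OF smoothed_carrier Suc.prems])
    ultimately show ?case
      using Suc.IH[of "?B *\<^sub>v w"] fourier_scalar_prod_smoothed[OF n, of "?c w" k \<alpha>] Suc.prems by simp
  qed
  have pow: "convergent (\<lambda>t. complex_of_real (cycle_eigenvalue \<alpha> n k ^ t))" for k
  proof (cases "cycle_eigenvalue \<alpha> n k = 1")
    case False
    \<comment> \<open>Since \<open>\<alpha> < 1\<close>, the lower bound
      \<open>1 - 2 * \<alpha>\<close> is strictly above \<open>-1\<close>.\<close>
    then have "\<bar>cycle_eigenvalue \<alpha> n k\<bar> < 1"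
      using cycle_eigenvalue_bounds[OF \<alpha>, of n k] \<alpha> by auto
    then have "(\<lambda>t. cycle_eigenvalue \<alpha> n k ^ t) \<longlonglongrightarrow> 0" by (intro LIMSEQ_abs_realpow_zero2)
    then show ?thesis using convergent_def tendsto_of_real by blast
  qed (simp add: convergent_const)
  have "convergent (\<lambda>t. (\<Sum>k<n. cis (- (2 * pi * real k * real l / real n)) *
      (fourier_vec n k \<bullet> ?c v) * complex_of_real (cycle_eigenvalue \<alpha> n k ^ t)) * inverse (of_nat n))"
    by (rule convergent_mult[OF convergent_sum[OF convergent_mult[OF convergent_const pow]] convergent_const])
  also have "(\<lambda>t. (\<Sum>k<n. cis (- (2 * pi * real k * real l / real n)) *
      (fourier_vec n k \<bullet> ?c v) * complex_of_real (cycle_eigenvalue \<alpha> n k ^ t)) * inverse (of_nat n)) =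
      (\<lambda>t. complex_of_real (((?B ^\<^sub>m t) *\<^sub>v v) $ l))"
  proof
    fix t
    have car: "(?B ^\<^sub>m t) *\<^sub>v v \<in> carrier_vec n"
      using v by (intro mult_mat_vec_carrier[of _ n n] pow_carrier_mat) auto
    then have "?c ((?B ^\<^sub>m t) *\<^sub>v v) \<in> carrier_vec n" by simp
    from fourier_inversion[OF this l] car
    show "(\<Sum>k<n. cis (- (2 * pi * real k * real l / real n)) *
      (fourier_vec n k \<bullet> ?c v) * complex_of_real (cycle_eigenvalue \<alpha> n k ^ t)) * inverse (of_nat n) =
      complex_of_real (((?B ^\<^sub>m t) *\<^sub>v v) $ l)"
      using n l by (simp add: step[OF v] ac_simps)
  qed
  finally obtain L where "(\<lambda>t. complex_of_real (((?B ^\<^sub>m t) *\<^sub>v v) $ l)) \<longlonglongrightarrow> L"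
    unfolding convergent_def by blast
  from tendsto_Re[OF this] show "convergent (\<lambda>t. ((?B ^\<^sub>m t) *\<^sub>v v) $ l)"
    unfolding convergent_def by auto
qed


section \<open>Asymptotics of the convergence time\<close>

text \<open>Up to \<open>n / 2\<close> the angle stays within \<open>[0, pi]\<close>, where cosine
  decreases; larger \<open>k\<close> are reflected to \<open>n - k\<close>.\<close>

lemma cos_le_cos_first:
  assumes "0 < k" "k < n"
  shows "cos (2 * pi * real k / real n) \<le> cos (2 * pi / real n)"
proof -
  have half: "cos (2 * pi * real d / real n) \<le> cos (2 * pi / real n)" if "0 < d" "2 * d \<le> n" for d
  proof -
    have "real (2 * d) \<le> real n" using that by (simp only: of_nat_le_iff)
    then have "pi * real (2 * d) \<le> pi * real n" by (intro mult_left_mono) auto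
    then show ?thesis using that
      by (intro cos_monotone_0_pi_le) (auto simp: field_simps)
  qed
  show ?thesis
  proof (cases "2 * k \<le> n")
    case False
    have "2 * pi * real k / real n = 2 * pi - 2 * pi * real (n - k) / real n"
      using assms by (simp add: field_simps)
    then have "cos (2 * pi * real k / real n) = cos (2 * pi * real (n - k) / real n)"
      by (simp add: cos_diff)
    then show ?thesis using half[of "n - k"] False assms by simp
  qed (use half assms in simp)
qed

text \<open>Only eventual: for small \<open>n\<close> a negative eigenvalue can have the larger
  modulus.\<close>

lemma lambda2_smoothed:
  assumes \<alpha>: "0 < \<alpha>" "\<alpha> < 1"
  shows "\<forall>\<^sub>F n in sequentially. lambda2 (smoothed_cycle_mat \<alpha> n) = cycle_eigenvalue \<alpha> n 1"
proof -
  have "(\<lambda>n. cycle_eigenvalue \<alpha> n 1) \<longlonglongrightarrow> 1"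
    unfolding cycle_eigenvalue_def by real_asymp
  \<comment> \<open>\<open>2 * \<alpha> - 1\<close> bounds the modulus of all negative eigenvalues;
    \<open>0\<close> makes the candidate equal to its own modulus.\<close>
  then have "\<forall>\<^sub>F n in sequentially. max 0 (2 * \<alpha> - 1) < cycle_eigenvalue \<alpha> n 1"
    using \<alpha> by (intro order_tendstoD) auto
  then show ?thesis using eventually_ge_at_top[of 2]
  proof eventually_elim
    case (elim n)
    have "2 * pi / real n \<le> pi" "0 < 2 * pi / real n" using elim by (auto simp: field_simps)
    then have "cos (2 * pi / real n) < 1" using cos_monotone_0_pi[of 0 "2 * pi / real n"] by simp
    then have less1: "cycle_eigenvalue \<alpha> n 1 < 1" using \<alpha> by (simp add: cycle_eigenvalue_def)
    have le: "\<bar>cycle_eigenvalue \<alpha> n k\<bar> \<le> cycle_eigenvalue \<alpha> n 1"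
      if "k < n" "\<bar>cycle_eigenvalue \<alpha> n k\<bar> < 1" for k
    proof -
      \<comment> \<open>Index \<open>0\<close> carries the eigenvalue \<open>1\<close>, which the
        modulus condition excludes.\<close>
      have "k \<noteq> 0" using that by (intro notI) (simp add: cycle_eigenvalue_def)
      then have "cycle_eigenvalue \<alpha> n k \<le> cycle_eigenvalue \<alpha> n 1"
        using cos_le_cos_first[of k n] that \<alpha> by (simp add: cycle_eigenvalue_def)
      then show ?thesis using cycle_eigenvalue_bounds(1)[OF \<alpha>, of n k] elim by auto
    qed
    have "{cmod \<mu> | \<mu>. \<mu> \<in> spectrum (complex_smoothed \<alpha> n) \<and> cmod \<mu> < 1} =
        cmod ` {\<mu> \<in> spectrum (complex_smoothed \<alpha> n). cmod \<mu> < 1}"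
      by blast
    also have "{\<mu> \<in> spectrum (complex_smoothed \<alpha> n). cmod \<mu> < 1} =
        (\<lambda>k. complex_of_real (cycle_eigenvalue \<alpha> n k)) ` {k. k < n \<and> \<bar>cycle_eigenvalue \<alpha> n k\<bar> < 1}"
      using elim by (auto simp: spectrum_smoothed)
    finally have set: "{cmod \<mu> | \<mu>. \<mu> \<in> spectrum (complex_smoothed \<alpha> n) \<and> cmod \<mu> < 1} =
        (\<lambda>k. \<bar>cycle_eigenvalue \<alpha> n k\<bar>) ` {k. k < n \<and> \<bar>cycle_eigenvalue \<alpha> n k\<bar> < 1}"
      by (simp add: image_image)
    show ?case unfolding lambda2_def set
      using le less1 elim by (intro Max_eqI) (auto intro!: image_eqI[of _ _ 1])
  qed
qed

text \<open>In a continuous angle \<open>h\<close>, the error is a difference of order at most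
  \<open>h ^ 4\<close> divided by a rate of order \<open>h ^ 2\<close>.\<close>

lemma ln_cos_error_bigo:
  assumes \<alpha>: "0 < (\<alpha>::real)"
  shows "(\<lambda>h. \<alpha> * h ^ 2 / 2 / ln (1 / (1 - \<alpha> + \<alpha> * cos h)) - 1) \<in> O[at_right 0](\<lambda>h. h ^ 2)"
proof -
  define z where "z = (\<lambda>h. \<alpha> * (1 - cos h))"
  define D where "D = (\<lambda>h. ln (1 / (1 - z h)))"
  \<comment> \<open>Positivity of \<open>1 - cos h\<close> gives the approach from the right that
    composition with the logarithm estimates requires.\<close>
  have z: "filterlim z (at_right 0) (at_right 0)"
    unfolding z_def using \<alpha> by real_asymp
  have z2: "(\<lambda>h. (z h) ^ 2) \<in> O[at_right 0](\<lambda>h. h ^ 4)"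
    unfolding z_def using \<alpha> by real_asymp
  have zi: "(\<lambda>h. inverse (z h)) \<in> O[at_right 0](\<lambda>h. inverse (h ^ 2))"
    unfolding z_def using \<alpha> by real_asymp
  \<comment> \<open>The logarithm is expanded in \<open>z\<close> alone and composed with
    \<open>z h\<close> afterwards.\<close>
  have ln2: "(\<lambda>z::real. ln (1 / (1 - z)) - z) \<in> O[at_right 0](\<lambda>z. z ^ 2)"
    and lni: "(\<lambda>z::real. inverse (ln (1 / (1 - z)))) \<in> O[at_right 0](\<lambda>z. inverse z)"
    and pos: "\<forall>\<^sub>F z::real in at_right 0. 0 < ln (1 / (1 - z))"
    by real_asymp+
  have "(\<lambda>h. D h - z h) \<in> O[at_right 0](\<lambda>h. h ^ 4)"
    unfolding D_def by (rule landau_o.big_trans[OF landau_o.big.compose[OF ln2 z] z2])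
  moreover have "(\<lambda>h. \<alpha> * h ^ 2 / 2 - z h) \<in> O[at_right 0](\<lambda>h. h ^ 4)"
    unfolding z_def using \<alpha> by real_asymp
  \<comment> \<open>Both \<open>\<alpha> * h ^ 2 / 2\<close> and \<open>D h\<close> are compared
    with \<open>z h\<close>, which cancels.\<close>
  ultimately have "(\<lambda>h. (\<alpha> * h ^ 2 / 2 - z h) - (D h - z h)) \<in> O[at_right 0](\<lambda>h. h ^ 4)"
    by (rule sum_in_bigo(2)[rotated])
  moreover have "(\<lambda>h. inverse (D h)) \<in> O[at_right 0](\<lambda>h. inverse (h ^ 2))"
    unfolding D_def by (rule landau_o.big_trans[OF landau_o.big.compose[OF lni z] zi])
  ultimately have "(\<lambda>h. ((\<alpha> * h ^ 2 / 2 - z h) - (D h - z h)) * inverse (D h))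
      \<in> O[at_right 0](\<lambda>h. h ^ 4 * inverse (h ^ 2))"
    by (rule landau_o.big.mult)
  also have "(\<lambda>h. h ^ 4 * inverse (h ^ 2)) = (\<lambda>h::real. h ^ 2)"
    by (rule ext) (simp add: field_simps eval_nat_numeral)
  finally have *: "(\<lambda>h. ((\<alpha> * h ^ 2 / 2 - z h) - (D h - z h)) * inverse (D h))
      \<in> O[at_right 0](\<lambda>h. h ^ 2)" .
  \<comment> \<open>Justifies the division by \<open>D h\<close>.\<close>
  have "\<forall>\<^sub>F h in at_right 0. 0 < D h"
    unfolding D_def by (rule eventually_compose_filterlim[OF pos z])
  then have "\<forall>\<^sub>F h in at_right 0.
      ((\<alpha> * h ^ 2 / 2 - z h) - (D h - z h)) * inverse (D h) = \<alpha> * h ^ 2 / 2 / D h - 1"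
    by eventually_elim (simp add: field_simps)
  from landau_o.big.in_cong[OF this] * have "(\<lambda>h. \<alpha> * h ^ 2 / 2 / D h - 1) \<in> O[at_right 0](\<lambda>h. h ^ 2)"
    by simp
  moreover have "1 - z h = 1 - \<alpha> + \<alpha> * cos h" for h
    by (simp add: z_def algebra_simps)
  ultimately show ?thesis unfolding D_def by simp
qed

text \<open>Substitutes \<open>h = 2 * pi / n\<close>, which tends to \<open>0\<close> from the
  right.\<close>

lemma convergence_error_bigo:
  assumes \<alpha>: "0 < \<alpha>"
  shows "(\<lambda>n. 2 * \<alpha> * pi ^ 2 / real n ^ 2 * (1 / ln (1 / cycle_eigenvalue \<alpha> n 1)) - 1)
    \<in> O(\<lambda>n. 1 / real n ^ 2)"
proof -
  have "filterlim (\<lambda>n. 2 * pi / real n) (at_right 0) sequentially"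
    by real_asymp
  from landau_o.big.compose[OF ln_cos_error_bigo[OF \<alpha>] this]
  have "(\<lambda>n. 2 * \<alpha> * pi ^ 2 / real n ^ 2 * (1 / ln (1 / cycle_eigenvalue \<alpha> n 1)) - 1)
      \<in> O(\<lambda>n. (2 * pi / real n) ^ 2)"
    by (simp add: cycle_eigenvalue_def power_divide power_mult_distrib field_simps)
  also have "(\<lambda>n. (2 * pi / real n) ^ 2) \<in> O(\<lambda>n. 1 / real n ^ 2)"
    by real_asymp
  finally show ?thesis .
qed

theorem theorem2:
  fixes \<alpha> :: real
  assumes "0 < \<alpha>" and "\<alpha> < 1"
  shows "(\<forall>n\<ge>2. cycle_dynamics_is_linear n \<alpha> (smoothed_cycle_mat \<alpha> n)
              \<and> convergent_system (smoothed_cycle_mat \<alpha> n))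
       \<and> (\<exists>e :: nat \<Rightarrow> real. e \<in> O(\<lambda>n. 1 / real n ^ 2)
              \<and> (\<forall>\<^sub>F n in sequentially. convergence_time (smoothed_cycle_mat \<alpha> n)
                    = 1 / (2 * \<alpha> * pi ^ 2) * real n ^ 2 * (1 + e n)))"
proof (intro conjI allI impI exI)
  fix n :: nat assume "2 \<le> n"
  then show "cycle_dynamics_is_linear n \<alpha> (smoothed_cycle_mat \<alpha> n)"
    "convergent_system (smoothed_cycle_mat \<alpha> n)"
    using assms by (auto intro: cycle_dynamics_linear convergent_smoothed)
next
  \<comment> \<open>The witness \<open>e\<close> is the convergence time divided by its leading
    term, minus \<open>1\<close>, with \<open>lambda2\<close> replaced by its eventual
    value.\<close>
  show "(\<lambda>n. 2 * \<alpha> * pi ^ 2 / real n ^ 2 * (1 / ln (1 / cycle_eigenvalue \<alpha> n 1)) - 1)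
    \<in> O(\<lambda>n. 1 / real n ^ 2)"
    by (rule convergence_error_bigo[OF assms(1)])
  show "\<forall>\<^sub>F n in sequentially. convergence_time (smoothed_cycle_mat \<alpha> n)
      = 1 / (2 * \<alpha> * pi ^ 2) * real n ^ 2 *
        (1 + (2 * \<alpha> * pi ^ 2 / real n ^ 2 * (1 / ln (1 / cycle_eigenvalue \<alpha> n 1)) - 1))"
    using lambda2_smoothed[OF assms] eventually_gt_at_top[of 0]
  proof eventually_elim
    case (elim n)
    then show ?case using assms
      by (simp add: convergence_time_def convergence_rate_def)
  qed
qed

end
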